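(* Let $X$ be a Hilbert space, let $A,B\subset X$ be closed sets and $\bar x\in A\cap B$. Suppose that $\{A,B\}$ is uniformly regular at $\bar x$, i.e., $\hat c[A,B](\bar x)<1$, that $A$ is super-regular at $\bar x$, and that $\sigma\in[0,1)$ satisfies $$c_0:=\hat{c}[A,B](\bar x)(1-\sigma^2)+\sigma^2+2\sigma\sqrt{1-\sigma^2}+\sigma<1.$$ Then, for any $c\in(c_0,1)$ with $c>0$, there exists $r>0$ such that any sequence $\{x_k\}_{k\ge0}$ of $\sigma$-alternating projections for $\{A,B\}$ with initial points $x_0$ and $x_1$ satisfying $\|x_0-\bar x\|<r$ and $\|x_1-\bar x\|<r$ converges to a point in $A\cap B$ with $R$-linear rate $\sqrt{c}$.
   Context: Let $X$ be a real Hilbert space. $d(x,A):=\inf_{a\in A}\|x-a\|$, $\mathbb{B}_\rho(\bar x)$ is the open ball of radius $\rho$ centred at $\bar x$, and $\mathbb{S}$ is the unit sphere of $X$. The Fréchet normal cone to $A$ at $a\in A$ is $$N_A(a):=\Big\{u\in X \;\Big|\; \limsup_{x\to a,\,x\in A\setminus\{a\}}\frac{\langle u,x-a\rangle}{\|x-a\|}\le 0\Big\}$$ (equal to $X$ if $a$ is an isolated point of $A$). The constant $\hat c$ is defined by $$\hat c[A,B](\bar x):=\lim_{\rho\downarrow0}\sup\{-\langle u,v\rangle\mid u\in N_A(a)\cap\mathbb{S},\ v\in N_B(b)\cap\mathbb{S},\ a\in A\cap \mathbb{B}_{\rho}(\bar x),\ b\in B\cap \mathbb{B}_{\rho}(\bar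 x)\},$$ with $\sup\emptyset=-\infty$ (if $\hat c[A,B](\bar x)=-\infty$, then $c_0=-\infty$). In a Hilbert space, the collection of closed sets $\{A,B\}$ is uniformly regular at $\bar x\in A\cap B$ if and only if $\hat c[A,B](\bar x)<1$. The closed set $A$ is super-regular at $\bar x\in A$ if for any $\gamma>0$ there exists a $\delta>0$ such that $\langle u,x-a\rangle\le\gamma\|u\|\,\|x-a\|$ for all $x,a\in A\cap\mathbb{B}_\delta(\bar x)$ and $u\in N_A(a)$. For $\sigma\in[0,1)$, the $\sigma$-projection of $x\in X$ on $A$ is the set $$P_{A}^\sigma(x):= \{a\in A \mid d(x-a,N_A(a))\le \sigma\|x-a\|\}.$$ A sequence $\{x_n\}$ is a sequence of $\sigma$-alternating projections for $\{A,B\}$ if, for all $n=0,1,\ldots$, $x_{2n+1}\in P_B^{\sigma}(x_{2n})$, $x_{2n+2}\in P_A^{\sigma}(x_{2n+1})$, and $\|x_{n+2}-x_{n+1}\|\le\|x_{n+1}-x_{n}\|$. A sequence $\{x_n\}$ converges to $x^*$ with $R$-linear rate $q\in(0,1)$ if there is a constant $C\ge0$ such that $\|x_n-x^*\|\le C q^n$ for all $n$. *)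

theory Defs
  imports "HOL-Analysis.Analysis"
begin

text \<open>Since \<^term>\<open>at a within A\<close> excludes \<open>a\<close>, the filter is trivial at an isolated point of \<open>A\<close>;
  there the upper limit is \<open>-\<infinity>\<close> and the cone is the whole space.\<close>

definition normal_cone :: "'a::real_inner set \<Rightarrow> 'a \<Rightarrow> 'a set" where
  "normal_cone A a =
     {u. Limsup (at a within A) (\<lambda>x. ereal (inner u (x - a) / norm (x - a))) \<le> 0}"

lemma normal_cone_isolated:
  assumes "\<not> a islimpt A"
  shows "normal_cone A a = UNIV"
proof -
  have "at a within A = bot"
    using assms trivial_limit_within by blast
  then show ?thesis
    unfolding normal_cone_def by (simp add: Limsup_bot)
qed

text \<open>Suprema are taken in \<^typ>\<open>ereal\<close>, so the supremum of the empty set is \<open>-\<infinity>\<close>.\<close>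

definition c_hat_sup :: "'a::real_inner set \<Rightarrow> 'a set \<Rightarrow> 'a \<Rightarrow> real \<Rightarrow> ereal" where
  "c_hat_sup A B xbar \<rho> =
     Sup {ereal (- inner u v) | u v a b.
            u \<in> normal_cone A a \<inter> sphere 0 1 \<and> v \<in> normal_cone B b \<inter> sphere 0 1 \<and>
            a \<in> A \<inter> ball xbar \<rho> \<and> b \<in> B \<inter> ball xbar \<rho>}"

definition c_hat :: "'a::real_inner set \<Rightarrow> 'a set \<Rightarrow> 'a \<Rightarrow> ereal" where
  "c_hat A B xbar = Lim (at_right 0) (c_hat_sup A B xbar)"

lemma c_hat_sup_mono:
  assumes "\<rho> \<le> \<rho>'"
  shows "c_hat_sup A B xbar \<rho> \<le> c_hat_sup A B xbar \<rho>'"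
  unfolding c_hat_sup_def
  by (rule Sup_subset_mono) (use assms subset_ball[OF assms, of xbar] in blast)

lemma c_hat_tendsto: "(c_hat_sup A B xbar \<longlongrightarrow> c_hat A B xbar) (at_right 0)"
proof -
  let ?f = "c_hat_sup A B xbar"
  have "(?f \<longlongrightarrow> (INF \<rho>\<in>{0<..}. ?f \<rho>)) (at_right 0)"
  proof (rule order_tendstoI)
    fix l assume l: "l < (INF \<rho>\<in>{0<..}. ?f \<rho>)"
    show "\<forall>\<^sub>F \<rho> in at_right 0. l < ?f \<rho>"
      using eventually_at_right_less[of "0::real"]
      by eventually_elim (use l in \<open>auto intro: less_le_trans INF_lower\<close>)
  next
    fix l assume "(INF \<rho>\<in>{0<..}. ?f \<rho>) < l"
    then obtain \<rho>' where "0 < \<rho>'" "?f \<rho>' < l"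
      by (auto simp: INF_less_iff)
    then show "\<forall>\<^sub>F \<rho> in at_right 0. ?f \<rho> < l"
      unfolding eventually_at_right_field
      by (meson c_hat_sup_mono le_less_trans less_imp_le)
  qed
  then show ?thesis
    unfolding c_hat_def by (metis tendsto_Lim trivial_limit_at_right_real)
qed

definition super_regular_at :: "'a::real_inner set \<Rightarrow> 'a \<Rightarrow> bool" where
  "super_regular_at A xbar \<longleftrightarrow>
     (\<forall>\<gamma>>0. \<exists>\<delta>>0. \<forall>x\<in>A \<inter> ball xbar \<delta>. \<forall>a\<in>A \<inter> ball xbar \<delta>. \<forall>u\<in>normal_cone A a.
        inner u (x - a) \<le> \<gamma> * norm u * norm (x - a))"

text \<open>\<^const>\<open>infdist\<close> is the infimum of distances here, because a normal cone contains \<open>0\<close>.\<close>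

definition sigma_projection :: "real \<Rightarrow> 'a::real_inner set \<Rightarrow> 'a \<Rightarrow> 'a set" where
  "sigma_projection \<sigma> A x = {a \<in> A. infdist (x - a) (normal_cone A a) \<le> \<sigma> * norm (x - a)}"

lemma zero_in_normal_cone: "0 \<in> normal_cone A a"
  by (cases "at a within A = bot")
     (simp_all add: normal_cone_def Limsup_bot Limsup_const flip: zero_ereal_def)

definition sigma_alternating_projections ::
    "real \<Rightarrow> 'a::real_inner set \<Rightarrow> 'a set \<Rightarrow> (nat \<Rightarrow> 'a) \<Rightarrow> bool" where
  "sigma_alternating_projections \<sigma> A B x \<longleftrightarrow>
     (\<forall>n. x (2 * n + 1) \<in> sigma_projection \<sigma> B (x (2 * n)) \<and>
          x (2 * n + 2) \<in> sigma_projection \<sigma> A (x (2 * n + 1)) \<and>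
          norm (x (n + 2) - x (n + 1)) \<le> norm (x (n + 1) - x n))"

definition converges_R_linearly :: "(nat \<Rightarrow> 'a::real_normed_vector) \<Rightarrow> 'a \<Rightarrow> real \<Rightarrow> bool" where
  "converges_R_linearly x l q \<longleftrightarrow>
     0 < q \<and> q < 1 \<and> x \<longlonglongrightarrow> l \<and> (\<exists>C\<ge>0. \<forall>n. norm (x n - l) \<le> C * q ^ n)"

text \<open>For \<open>0 \<le> \<sigma> < 1\<close> the factor \<open>1 - \<sigma>\<^sup>2\<close> is positive, so the value is \<open>-\<infinity>\<close>
  when \<^const>\<open>c_hat\<close> is.\<close>

definition c_zero :: "real \<Rightarrow> 'a::real_inner set \<Rightarrow> 'a set \<Rightarrow> 'a \<Rightarrow> ereal" where
  "c_zero \<sigma> A B xbar =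
     c_hat A B xbar * ereal (1 - \<sigma>\<^sup>2) + ereal (\<sigma>\<^sup>2 + 2 * \<sigma> * sqrt (1 - \<sigma>\<^sup>2) + \<sigma>)"

end

theory Submission
  imports Defs
begin

text \<open>
  Consider one round \<open>a \<in> A\<close>, \<open>b \<in> B\<close>, \<open>a' \<in> A\<close> of the iteration near the reference point, with the
  displacements \<open>p = a - b\<close> and \<open>q = b - a'\<close>, where \<open>norm q \<le> norm p\<close>. By the definition of a
  \<open>\<sigma>\<close>-projection, \<open>p\<close> lies close to some normal \<open>v\<close> to \<open>B\<close> at \<open>b\<close>, and \<open>q\<close> close to some normal \<open>u\<close>
  to \<open>A\<close> at \<open>a'\<close>. Super-regularity bounds \<open>inner u (a - a') = inner u p + inner u q\<close> by a
  small error, so \<open>inner u q\<close> is at most \<open>- inner u p\<close> up to that error. The latter exceeds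
  \<open>- inner u v\<close> by at most \<open>norm u * norm (p - v)\<close>, and uniform regularity bounds \<open>- inner u v\<close> by a
  multiple of \<open>norm u * norm v\<close>. On the other hand \<open>inner u q\<close> falls short of \<open>(norm q)\<^sup>2\<close> only by the
  square of the residual \<open>q - u\<close>, if that is orthogonal to \<open>u\<close>. The two estimates together give
  \<open>norm q \<le> c * norm p\<close> (\<open>step_contraction\<close>).

  To lose nothing beyond \<open>c_zero\<close>, the normals are rescaled so that the residuals \<open>p - v\<close> and
  \<open>q - u\<close> are orthogonal to \<open>v\<close> and \<open>u\<close> (\<open>ray_projection\<close>). Each pair of normal and residual is
  then described by one angle, and the bound becomes an inequality between sines and cosines
  (\<open>angle_bound\<close>). Elements of a normal cone that almost attain the distance to it suffice
  once \<open>\<sigma>\<close> is replaced by a slightly larger \<open>S\<close>; the strict inequality \<open>c_zero < c\<close> leaves room for this, for a bound \<open>k\<close>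
  slightly above \<open>c_hat\<close>, and for the error of super-regularity (\<open>parameter_choice\<close>).

  Every second step contracts, by the factor \<open>c\<close>, and the other steps do not grow. This gives
  the rate \<open>sqrt c\<close> per step. The total length of the path is at most a constant times the first
  step, so a small starting ball keeps the sequence in the region where the contraction holds
  (\<open>local_contraction_converges\<close>).
\<close>

section \<open>Rays of the normal cone\<close>

lemma normal_cone_scaleR:
  assumes "u \<in> normal_cone A a" "0 < t"
  shows "t *\<^sub>R u \<in> normal_cone A a"
proof -
  have "\<forall>\<^sub>F x in at a within A. ereal (inner (t *\<^sub>R u) (x - a) / norm (x - a)) < y" if "0 < y" for y
  proof -
    obtain z where z: "0 < ereal z" "ereal z < y"
      using ereal_dense2[OF \<open>0 < y\<close>] by blast
    then have "0 < ereal (z / t)"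
      using assms(2) by simp
    then have "\<forall>\<^sub>F x in at a within A. ereal (inner u (x - a) / norm (x - a)) < ereal (z / t)"
      using assms(1) unfolding normal_cone_def mem_Collect_eq Limsup_le_iff by blast
    then show ?thesis
    proof eventually_elim
      case (elim x)
      then have "t * (inner u (x - a) / norm (x - a)) < z"
        using assms(2) by (simp add: pos_less_divide_eq mult.commute)
      then have "ereal (inner (t *\<^sub>R u) (x - a) / norm (x - a)) < ereal z"
        by simp
      then show ?case
        using z(2) less_trans by blast
    qed
  qed
  then show ?thesis
    unfolding normal_cone_def mem_Collect_eq Limsup_le_iff by blast
qed

text \<open>
  A point \<open>v\<close> of the cone whose distance to \<open>w\<close> is below \<open>S * norm w\<close> exists by definition of the
  infimum. Replacing it by the point of the ray through \<open>v\<close> nearest to \<open>w\<close> only decreases the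
  distance and makes the residual orthogonal to the ray.
\<close>

lemma ray_projection:
  fixes w :: "'a::real_inner"
  assumes cone: "0 \<in> N" "\<And>u t. u \<in> N \<Longrightarrow> 0 < t \<Longrightarrow> t *\<^sub>R u \<in> N"
    and near: "infdist w N \<le> \<sigma> * norm w" and "\<sigma> < S"
  obtains u where "u \<in> N" "inner u (w - u) = 0" "norm (w - u) \<le> S * norm w"
proof (cases "w = 0")
  case True
  then show ?thesis
    using that[of 0] cone(1) by simp
next
  case False
  then have "\<sigma> * norm w < S * norm w"
    using \<open>\<sigma> < S\<close> by simp
  with near have "infdist w N < S * norm w"
    by simp
  moreover have "N \<noteq> {}"
    using cone(1) by auto
  ultimately have "\<exists>v\<in>N. dist w v < S * norm w"
    by (simp add: infdist_notempty cINF_less_iff)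
  then obtain v where v: "v \<in> N" "norm (w - v) < S * norm w"
    unfolding dist_norm by blast
  show ?thesis
  proof (cases "0 < inner w v")
    case True
    then have "v \<noteq> 0"
      by auto
    then have vv: "0 < inner v v"
      by simp
    \<comment> \<open>the minimizer of \<open>norm (w - t *\<^sub>R v)\<close> over all real \<open>t\<close>\<close>
    define t where "t = inner w v / inner v v"
    have "0 < t"
      using True vv by (simp add: t_def)
    have orth: "inner v (w - t *\<^sub>R v) = 0"
      using vv by (simp add: t_def inner_diff_right inner_commute)
    have "(norm (w - v))\<^sup>2 = (norm (w - t *\<^sub>R v))\<^sup>2 + (norm ((t - 1) *\<^sub>R v))\<^sup>2"
    proof -
      have "w - v = (w - t *\<^sub>R v) + (t - 1) *\<^sub>R v"
        by (simp add: scaleR_left_diff_distrib)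
      then show ?thesis
        using orth
        by (simp only: power2_norm_eq_inner inner_add_left inner_add_right inner_scaleR_left
            inner_scaleR_right inner_commute[of "w - t *\<^sub>R v" v]) simp
    qed
    then have "(norm (w - t *\<^sub>R v))\<^sup>2 \<le> (norm (w - v))\<^sup>2"
      by simp
    then have "norm (w - t *\<^sub>R v) \<le> norm (w - v)"
      using power2_le_imp_le by fastforce
    then show ?thesis
      using that[of "t *\<^sub>R v"] cone(2)[OF v(1) \<open>0 < t\<close>] orth v(2) by simp
  next
    \<comment> \<open>the ray points away from \<open>w\<close>, so the apex \<open>0\<close> is its nearest point\<close>
    case False
    have "(norm (w - v))\<^sup>2 = (norm w)\<^sup>2 - 2 * inner w v + (norm v)\<^sup>2"
      by (simp add: power2_norm_eq_inner inner_diff_left inner_diff_right inner_commute)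
    then have "(norm w)\<^sup>2 \<le> (norm (w - v))\<^sup>2"
      using False by (smt (verit) zero_le_power2)
    then have "norm w \<le> norm (w - v)"
      using power2_le_imp_le by fastforce
    then show ?thesis
      using that[of 0] cone(1) v(2) by simp
  qed
qed

section \<open>Contraction in one round\<close>

text \<open>The formula of \<^const>\<open>c_zero\<close>, with a real bound \<open>k\<close> in place of \<^const>\<open>c_hat\<close>.\<close>

definition alternating_rate :: "real \<Rightarrow> real \<Rightarrow> real" where
  "alternating_rate S k = k * (1 - S\<^sup>2) + (S\<^sup>2 + 2 * S * sqrt (1 - S\<^sup>2) + S)"

text \<open>
  Here \<open>(x, y)\<close> and \<open>(z, w)\<close> are the cosine and sine of the angles between a displacement and the
  chosen normal, at \<open>A\<close> and at \<open>B\<close>. For \<open>k \<le> 0\<close> the summands are bounded one by one, using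
  \<open>x * z \<ge> 1 - S\<^sup>2\<close>. For \<open>k > 0\<close> the product \<open>k * x * z\<close> may exceed \<open>k * (1 - S\<^sup>2)\<close>, and the
  excess is paid by the term \<open>2 * S * sqrt (1 - S\<^sup>2)\<close>: the hypothesis that the whole expression is
  below \<open>1\<close> forces \<open>S\<^sup>2 + S < 1\<close>, hence \<open>S \<le> sqrt (1 - S\<^sup>2)\<close>.
\<close>

lemma angle_bound:
  fixes x y z w S k :: real
  assumes "x\<^sup>2 + y\<^sup>2 = 1" "z\<^sup>2 + w\<^sup>2 = 1" "0 \<le> x" "0 \<le> z" "0 \<le> y" "0 \<le> w" "y \<le> S" "w \<le> S"
    and "S < 1" "k < 1" "alternating_rate S k < 1"
  shows "y\<^sup>2 + x * (k * z + w) \<le> alternating_rate S k"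
proof -
  have S: "0 \<le> S"
    using assms by linarith
  define C where "C = sqrt (1 - S\<^sup>2)"
  have S1: "S\<^sup>2 \<le> 1"
    using S \<open>S < 1\<close> by (simp add: abs_square_le_1)
  have C: "0 \<le> C" "C\<^sup>2 = 1 - S\<^sup>2"
    using S1 by (simp_all add: C_def)
  have y2: "y\<^sup>2 \<le> S\<^sup>2" and w2: "w\<^sup>2 \<le> S\<^sup>2"
    using assms by (simp_all add: power_mono)
  have x1: "x \<le> 1" and z1: "z \<le> 1"
    using assms power2_le_imp_le[of x 1] power2_le_imp_le[of z 1]
    by (smt (verit) one_power2 zero_le_power2)+
  have xC: "C \<le> x" and zC: "C \<le> z"
    using assms y2 w2 C by (smt (verit) power2_le_imp_le)+
  have xz: "1 - S\<^sup>2 \<le> x * z"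
    using mult_mono[OF xC zC] assms C by (simp add: power2_eq_square)
  have xw: "x * w \<le> S"
    using mult_mono[OF x1 \<open>w \<le> S\<close>] assms by simp
  show ?thesis
  proof (cases "k \<le> 0")
    case True
    then have "k * (x * z) \<le> k * (1 - S\<^sup>2)"
      using xz by (simp add: mult_left_mono_neg)
    moreover have "0 \<le> S * C"
      using S C by simp
    ultimately show ?thesis
      using y2 xw by (simp add: alternating_rate_def algebra_simps flip: C_def)
  next
    case False
    have SC0: "0 \<le> S * C"
      using S C by simp
    have "0 \<le> k * (1 - S\<^sup>2)"
      using False S1 by simp
    then have "S\<^sup>2 + S < 1"
      using \<open>alternating_rate S k < 1\<close> SC0 unfolding alternating_rate_def by (fold C_def) (simp add: mult.assoc)
    moreover have SS: "S\<^sup>2 \<le> S"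
      using S \<open>S < 1\<close> by (simp add: power2_eq_square mult_left_le)
    ultimately have "S\<^sup>2 \<le> C\<^sup>2"
      using C by linarith
    then have "S \<le> C"
      using C power2_le_imp_le by blast
    then have SC: "S\<^sup>2 \<le> S * C"
      using S by (simp add: power2_eq_square mult_left_mono)
    have "C * C \<le> C * 1"
      using xC x1 C(1) by (intro mult_left_mono) auto
    then have "1 - S\<^sup>2 \<le> C"
      using C by (simp add: power2_eq_square)
    then have zx: "z - x \<le> S\<^sup>2"
      using z1 xC by linarith
    \<comment> \<open>since \<open>y\<^sup>2 = 1 - x\<^sup>2\<close>, the sum \<open>y\<^sup>2 + x * z\<close> equals \<open>1 + x * (z - x)\<close>\<close>
    have "x * (z - x) \<le> S\<^sup>2"
    proof -
      have "x * (z - x) \<le> x * S\<^sup>2"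
        using zx assms by (intro mult_left_mono) auto
      also have "\<dots> \<le> 1 * S\<^sup>2"
        using x1 by (intro mult_right_mono) auto
      finally show ?thesis by simp
    qed
    moreover have "k * (x * z - (1 - S\<^sup>2)) \<le> 1 * (x * z - (1 - S\<^sup>2))"
      using xz \<open>k < 1\<close> by (intro mult_right_mono) auto
    ultimately have "y\<^sup>2 + k * (x * z) + x * w \<le> k * (1 - S\<^sup>2) + S\<^sup>2 + S\<^sup>2 + S"
      using xw assms(1) by (simp add: algebra_simps power2_eq_square)
    then show ?thesis
      using SC SC0 by (simp add: alternating_rate_def algebra_simps flip: C_def)
  qed
qed

text \<open>
  Orthogonality of the residual turns \<open>inner u q\<close> into \<open>(norm u)\<^sup>2\<close>, which is
  \<open>(norm q)\<^sup>2\<close> minus the squared residual. Dividing by \<open>norm p\<close> and \<open>norm q\<close> leaves the expression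
  of \<open>angle_bound\<close>; the factor \<open>2\<close> at \<open>\<gamma>\<close> comes from \<open>norm (p + q) \<le> 2 * norm p\<close>.
\<close>

lemma step_contraction:
  fixes p q u v :: "'a::real_inner"
  assumes u: "inner u (q - u) = 0" "norm (q - u) \<le> S * norm q"
    and v: "inner v (p - v) = 0" "norm (p - v) \<le> S * norm p"
    and uv: "- inner u v \<le> k * norm u * norm v"
    and reg: "inner u (p + q) \<le> \<gamma> * norm u * norm (p + q)"
    and "norm q \<le> norm p" "0 \<le> \<gamma>" "S < 1" "k < 1" "alternating_rate S k < 1"
    and c: "alternating_rate S k + 2 * \<gamma> \<le> c" "0 < c"
  shows "norm q \<le> c * norm p"
proof (cases "q = 0")
  case True
  then show ?thesis
    using c(2) by simp
next
  case False
  define \<alpha> where "\<alpha> = norm p"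
  define \<beta> where "\<beta> = norm q"
  have pos: "0 < \<beta>" "0 < \<alpha>" "\<beta> \<le> \<alpha>"
    using False \<open>norm q \<le> norm p\<close> by (auto simp: \<alpha>_def \<beta>_def)
  define x y z w where "x = norm u / \<beta>" and "y = norm (q - u) / \<beta>"
    and "z = norm v / \<alpha>" and "w = norm (p - v) / \<alpha>"
  have pyth: "(norm b)\<^sup>2 + (norm (a - b))\<^sup>2 = (norm a)\<^sup>2" if "inner b (a - b) = 0" for a b :: 'a
    using that by (simp add: power2_norm_eq_inner inner_diff_left inner_diff_right inner_commute)
  have xy: "x\<^sup>2 + y\<^sup>2 = 1" and zw: "z\<^sup>2 + w\<^sup>2 = 1"
    using pyth[OF u(1)] pyth[OF v(1)] pos
    by (simp_all add: x_def y_def z_def w_def \<alpha>_def \<beta>_def power_divide flip: add_divide_distrib)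
  have "y \<le> S" "w \<le> S"
    using u(2) v(2) pos by (simp_all add: y_def w_def \<alpha>_def \<beta>_def pos_divide_le_eq)
  then have bound: "y\<^sup>2 + x * (k * z + w) \<le> alternating_rate S k"
    using xy zw assms pos by (intro angle_bound) (auto simp: x_def y_def z_def w_def)
  have nu: "norm u = x * \<beta>" and nv: "norm v = z * \<alpha>" and npv: "norm (p - v) = w * \<alpha>"
    using pos by (simp_all add: x_def z_def w_def)
  have x: "0 \<le> x" "x \<le> 1"
    using xy pos power2_le_imp_le[of x 1] by (auto simp: x_def) (smt (verit) zero_le_power2)
  have "(norm u)\<^sup>2 = inner u q"
    using u(1) by (simp add: power2_norm_eq_inner inner_diff_right)
  also have "\<dots> = inner u (p + q) - inner u v + inner (- u) (p - v)"
    by (simp add: inner_add_right inner_diff_right)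
  also have "\<dots> \<le> \<gamma> * norm u * (2 * \<alpha>) + k * norm u * norm v + norm u * norm (p - v)"
  proof -
    have "norm (p + q) \<le> 2 * \<alpha>"
      using norm_triangle_ineq[of p q] pos by (simp add: \<alpha>_def \<beta>_def)
    then have "\<gamma> * norm u * norm (p + q) \<le> \<gamma> * norm u * (2 * \<alpha>)"
      using \<open>0 \<le> \<gamma>\<close> by (intro mult_left_mono) auto
    moreover have "inner (- u) (p - v) \<le> norm u * norm (p - v)"
      using norm_cauchy_schwarz[of "- u" "p - v"] by simp
    ultimately show ?thesis
      using reg uv by linarith
  qed
  finally have "x\<^sup>2 * \<beta> * \<beta> \<le> (x * (k * z + w) + 2 * \<gamma> * x) * \<alpha> * \<beta>"
    by (simp add: nu nv npv algebra_simps power2_eq_square)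
  then have "x\<^sup>2 * \<beta> \<le> (x * (k * z + w) + 2 * \<gamma> * x) * \<alpha>"
    using pos by simp
  moreover have "\<beta> = x\<^sup>2 * \<beta> + y\<^sup>2 * \<beta>"
    using xy by (simp flip: distrib_right)
  moreover have "y\<^sup>2 * \<beta> \<le> y\<^sup>2 * \<alpha>"
    using pos by (intro mult_left_mono) auto
  ultimately have "\<beta> \<le> (y\<^sup>2 + x * (k * z + w) + 2 * \<gamma> * x) * \<alpha>"
    by (simp add: distrib_right)
  also have "\<dots> \<le> c * \<alpha>"
  proof -
    have "2 * \<gamma> * x \<le> 2 * \<gamma>"
      using x \<open>0 \<le> \<gamma>\<close> by (simp add: mult_left_le)
    then show ?thesis
      using bound c(1) pos by (intro mult_right_mono) auto
  qed
  finally show ?thesis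
    by (simp add: \<alpha>_def \<beta>_def)
qed

section \<open>From contraction to R-linear convergence\<close>

lemma geometric_steps_converge:
  fixes x :: "nat \<Rightarrow> 'a::{real_normed_vector, complete_space}"
  assumes q: "0 < q" "q < 1" and K: "0 \<le> K"
    and step: "\<And>n. norm (x (Suc n) - x n) \<le> K * q ^ n"
  shows "\<exists>l. converges_R_linearly x l q"
proof -
  \<comment> \<open>the right-hand side is the partial geometric sum in closed form, which telescopes in \<open>m\<close>\<close>
  have far: "norm (x (n + m) - x n) \<le> K / (1 - q) * (q ^ n - q ^ (n + m))" for n m
  proof (induction m)
    case (Suc m)
    have "norm (x (n + Suc m) - x n) \<le> norm (x (Suc (n + m)) - x (n + m)) + norm (x (n + m) - x n)"
      using norm_triangle_ineq[of "x (Suc (n + m)) - x (n + m)" "x (n + m) - x n"] by simp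
    also have "\<dots> \<le> K * q ^ (n + m) + K / (1 - q) * (q ^ n - q ^ (n + m))"
      using step Suc by (intro add_mono) auto
    also have "\<dots> = K / (1 - q) * (q ^ n - q ^ (n + Suc m))"
      using q by (simp add: field_simps)
    finally show ?case .
  qed simp
  have tail: "norm (x m - x n) \<le> K / (1 - q) * q ^ n" if "n \<le> m" for m n
  proof -
    have "norm (x m - x n) \<le> K / (1 - q) * (q ^ n - q ^ m)"
      using far[of n "m - n"] that by simp
    also have "\<dots> \<le> K / (1 - q) * q ^ n"
      using q K by (intro mult_left_mono) auto
    finally show ?thesis .
  qed
  have lim0: "(\<lambda>n. K / (1 - q) * q ^ n) \<longlonglongrightarrow> 0"
    using q by (intro tendsto_mult_right_zero LIMSEQ_power_zero) auto
  have "Cauchy x"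
  proof (rule CauchyI)
    fix e :: real
    assume "0 < e"
    then have "\<forall>\<^sub>F n in sequentially. K / (1 - q) * q ^ n < e / 2"
      by (intro order_tendstoD(2)[OF lim0]) simp
    then obtain M where M: "K / (1 - q) * q ^ M < e / 2"
      by (auto simp: eventually_sequentially)
    have "norm (x m - x n) < e" if "M \<le> m" "M \<le> n" for m n
    proof -
      have "norm (x m - x n) \<le> norm (x m - x M) + norm (x n - x M)"
        using norm_triangle_ineq4[of "x m - x M" "x n - x M"] by simp
      then show ?thesis
        using tail[OF that(1)] tail[OF that(2)] M by linarith
    qed
    then show "\<exists>M. \<forall>m\<ge>M. \<forall>n\<ge>M. norm (x m - x n) < e"
      by blast
  qed
  then obtain l where l: "x \<longlonglongrightarrow> l"
    using Cauchy_convergent_iff convergent_def by blast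
  have "norm (x n - l) \<le> K / (1 - q) * q ^ n" for n
  proof -
    have "(\<lambda>m. norm (x m - x n)) \<longlonglongrightarrow> norm (l - x n)"
      using l by (intro tendsto_intros)
    then have "norm (l - x n) \<le> K / (1 - q) * q ^ n"
      by (rule tendsto_upperbound) (use tail in \<open>auto simp: eventually_sequentially\<close>)
    then show ?thesis
      by (simp add: norm_minus_commute)
  qed
  moreover have "0 \<le> K / (1 - q)"
    using q K by simp
  ultimately show ?thesis
    using q l unfolding converges_R_linearly_def by blast
qed

text \<open>
  The contraction is known only inside \<open>ball p \<delta>\<close> and only from \<open>n = 1\<close> on: for alternating
  projections the starting point \<open>x 0\<close> may lie outside the super-regular set. The lost round is absorbed by the factor \<open>1 / c\<close> in the
  constant \<open>K\<close>. The induction carries the decay of the steps together with the distance to \<open>x 0\<close>,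
  since each is needed for the other: small steps keep the next points in the ball, and there
  the next round contracts. The condition on \<open>r\<close> says that starting radius plus total path length
  \<open>2 * K / (1 - c)\<close> stays within \<open>\<delta>\<close>, where \<open>K < 2 * r / c\<close>.
\<close>

lemma local_contraction_converges:
  fixes x :: "nat \<Rightarrow> 'a::{real_normed_vector, complete_space}"
  assumes c: "0 < c" "c < 1"
    and mono: "\<And>n. norm (x (n + 2) - x (n + 1)) \<le> norm (x (n + 1) - x n)"
    and contr: "\<And>n. 1 \<le> n \<Longrightarrow> x (2 * n) \<in> ball p \<delta> \<Longrightarrow> x (2 * n + 1) \<in> ball p \<delta> \<Longrightarrow>
      x (2 * n + 2) \<in> ball p \<delta> \<Longrightarrow>
      norm (x (2 * n + 2) - x (2 * n + 1)) \<le> c * norm (x (2 * n + 1) - x (2 * n))"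
    and init: "norm (x 0 - p) < r" "norm (x 1 - p) < r"
    and r: "r * (1 + 4 / (c * (1 - c))) \<le> \<delta>"
  shows "\<exists>l. converges_R_linearly x l (sqrt c)"
proof -
  define K where "K = norm (x 1 - x 0) / c"
  have K: "0 \<le> K" "norm (x 1 - x 0) = K * c"
    using c by (simp_all add: K_def)
  have "K * c < 2 * r"
    using norm_triangle_ineq4[of "x 1 - p" "x 0 - p"] init K by simp
  then have "2 * (K * c) / (c * (1 - c)) \<le> 2 * (2 * r) / (c * (1 - c))"
    using c by (intro divide_right_mono) auto
  then have "2 * K / (1 - c) \<le> 4 * r / (c * (1 - c))"
    using c by simp
  then have radius: "r + 2 * K / (1 - c) \<le> \<delta>"
    using r by (simp add: distrib_left mult.commute)
  have inball: "x n \<in> ball p \<delta>" if "norm (x n - x 0) \<le> 2 * K / (1 - c)" for n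
    using norm_triangle_ineq[of "x n - x 0" "x 0 - p"] that init radius
    by (simp add: dist_norm norm_minus_commute)
  have main: "norm (x (2 * n + 1) - x (2 * n)) \<le> K * c ^ n \<and>
      norm (x (2 * n) - x 0) \<le> 2 * K / (1 - c) * (1 - c ^ n) \<and>
      norm (x (2 * n + 2) - x (2 * n + 1)) \<le> K * c ^ (n + 1)" for n
  proof (induction n)
    case 0
    have "K * c \<le> K"
      using K c by (simp add: mult_left_le)
    then show ?case
      using K mono[of 0] by simp
  next
    case (Suc n)
    let ?m = "Suc n"
    have d0: "norm (x (2 * ?m + 1) - x (2 * ?m)) \<le> K * c ^ ?m"
      using mono[of "2 * n + 1"] Suc by (simp add: numeral_eq_Suc)
    have cm: "norm (x (2 * n + 2) - x (2 * n + 1)) \<le> K * c ^ n"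
      using mono[of "2 * n"] Suc by simp
    have far: "norm (x (2 * ?m) - x 0) \<le> 2 * K / (1 - c) * (1 - c ^ ?m)"
    proof -
      have "norm (x (2 * ?m) - x 0) \<le> norm (x (2 * n + 2) - x (2 * n + 1))
          + norm (x (2 * n + 1) - x (2 * n)) + norm (x (2 * n) - x 0)"
        using norm_triangle_ineq[of "x (2 * n + 2) - x (2 * n + 1)" "x (2 * n + 1) - x (2 * n)"]
          norm_triangle_ineq[of "x (2 * n + 2) - x (2 * n)" "x (2 * n) - x 0"]
        by simp
      also have "\<dots> \<le> 2 * (K * c ^ n) + 2 * K / (1 - c) * (1 - c ^ n)"
        using cm Suc by linarith
      also have "\<dots> = 2 * K / (1 - c) * (1 - c ^ ?m)"
        using c by (simp add: field_simps)
      finally show ?thesis .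
    qed
    have d1: "norm (x (2 * ?m + 2) - x (2 * ?m + 1)) \<le> K * c ^ ?m"
      using mono[of "2 * ?m"] d0 by simp
    have geo: "2 * K / (1 - c) * (1 - c ^ j) \<le> 2 * K / (1 - c)" for j
    proof -
      have "2 * K / (1 - c) * (1 - c ^ j) \<le> 2 * K / (1 - c) * 1"
        using c K by (intro mult_left_mono) auto
      then show ?thesis by simp
    qed
    have split: "2 * K / (1 - c) * (1 - c ^ ?m) + 2 * (K * c ^ ?m) = 2 * K / (1 - c) * (1 - c ^ Suc ?m)"
      using c by (simp add: field_simps)
    have Kc: "0 \<le> K * c ^ ?m"
      using K c by simp
    have b0: "x (2 * ?m) \<in> ball p \<delta>"
      using inball far geo[of ?m] by fastforce
    have f1: "norm (x (2 * ?m + 1) - x 0) \<le> 2 * K / (1 - c)"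
      using norm_triangle_ineq[of "x (2 * ?m + 1) - x (2 * ?m)" "x (2 * ?m) - x 0"]
        d0 far split Kc geo[of "Suc ?m"] by simp
    have f2: "norm (x (2 * ?m + 2) - x 0) \<le> 2 * K / (1 - c)"
      using norm_triangle_ineq[of "x (2 * ?m + 1) - x (2 * ?m)" "x (2 * ?m) - x 0"]
        norm_triangle_ineq[of "x (2 * ?m + 2) - x (2 * ?m + 1)" "x (2 * ?m + 1) - x 0"]
        d0 d1 far split Kc geo[of "Suc ?m"] by simp
    have "norm (x (2 * ?m + 2) - x (2 * ?m + 1)) \<le> c * norm (x (2 * ?m + 1) - x (2 * ?m))"
      using contr[of ?m] b0 inball[OF f1] inball[OF f2] by simp
    also have "\<dots> \<le> c * (K * c ^ ?m)"
      using d0 c by (intro mult_left_mono) auto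
    finally have "norm (x (2 * ?m + 2) - x (2 * ?m + 1)) \<le> K * c ^ (?m + 1)"
      by (simp add: mult_ac)
    with d0 far show ?case by blast
  qed
  define q where "q = sqrt c"
  have q: "0 < q" "q < 1" and qc: "c = q\<^sup>2"
    using c by (simp_all add: q_def real_sqrt_lt_1_iff)
  have "norm (x (Suc n) - x n) \<le> K * q ^ n" for n
  proof (cases "even n")
    case True
    then obtain m where "n = 2 * m" by blast
    then show ?thesis
      using main[of m] by (simp add: qc power_mult)
  next
    case False
    then obtain m where m: "n = 2 * m + 1" by (metis oddE)
    have "norm (x (Suc n) - x n) \<le> K * q ^ Suc n"
    proof -
      have "q ^ Suc n = c ^ (m + 1)"
        by (simp add: m qc flip: power_mult) (simp add: power2_eq_square)
      then show ?thesis
        using main[of m] by (simp add: m)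
    qed
    also have "\<dots> \<le> K * q ^ n"
      using q K by (intro mult_left_mono power_decreasing) auto
    finally show ?thesis .
  qed
  then show ?thesis
    using geometric_steps_converge[OF q K(1)] unfolding q_def by blast
qed

section \<open>Constants and conclusion\<close>

lemma c_hat_local_bound:
  assumes "c_hat A B p < ereal k"
  obtains \<rho> where "0 < \<rho>"
    "\<And>a b u v. a \<in> A \<inter> ball p \<rho> \<Longrightarrow> b \<in> B \<inter> ball p \<rho> \<Longrightarrow> u \<in> normal_cone A a \<Longrightarrow>
      v \<in> normal_cone B b \<Longrightarrow> - inner u v \<le> k * norm u * norm v"
proof -
  have "\<forall>\<^sub>F \<rho> in at_right 0. c_hat_sup A B p \<rho> < ereal k"
    using order_tendstoD(2)[OF c_hat_tendsto assms] .
  then obtain e where e: "0 < e" "\<And>\<rho>. 0 < \<rho> \<Longrightarrow> \<rho> < e \<Longrightarrow> c_hat_sup A B p \<rho> < ereal k"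
    unfolding eventually_at_right_field by blast
  define \<rho> where "\<rho> = e / 2"
  have \<rho>: "0 < \<rho>" "c_hat_sup A B p \<rho> < ereal k"
    using e by (simp_all add: \<rho>_def)
  have "- inner u v \<le> k * norm u * norm v"
    if mem: "a \<in> A \<inter> ball p \<rho>" "b \<in> B \<inter> ball p \<rho>" "u \<in> normal_cone A a" "v \<in> normal_cone B b"
    for a b u v
  proof (cases "u = 0 \<or> v = 0")
    case False
    define u' v' where "u' = (1 / norm u) *\<^sub>R u" and "v' = (1 / norm v) *\<^sub>R v"
    have "u' \<in> normal_cone A a \<inter> sphere 0 1" "v' \<in> normal_cone B b \<inter> sphere 0 1"
      using mem False by (auto simp: u'_def v'_def intro!: normal_cone_scaleR)
    then have "ereal (- inner u' v') \<le> c_hat_sup A B p \<rho>"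
      unfolding c_hat_sup_def using mem by (intro Sup_upper) blast
    then have "ereal (- inner u' v') < ereal k"
      using \<rho>(2) by (rule le_less_trans)
    then have "- inner u' v' \<le> k"
      by simp
    then have "- inner u' v' * (norm u * norm v) \<le> k * (norm u * norm v)"
      by (intro mult_right_mono) auto
    moreover have "- inner u v = - inner u' v' * (norm u * norm v)"
      using False by (simp add: u'_def v'_def)
    ultimately show ?thesis
      by (simp only: mult.assoc)
  qed auto
  with \<rho>(1) show ?thesis
    by (rule that)
qed

text \<open>
  The real \<open>k\<close> is chosen first: as \<open>1 - \<sigma>\<^sup>2 > 0\<close>, the hypothesis says that \<open>h\<close> lies strictly below
  a real threshold, also when \<open>h = - \<infinity>\<close>. Then \<open>S\<close> comes from continuity of the rate in \<open>\<sigma>\<close>, and \<open>\<gamma>\<close>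
  takes up the remaining gap.
\<close>

lemma parameter_choice:
  assumes "h < 1" "0 \<le> \<sigma>" "\<sigma> < 1"
    and "h * ereal (1 - \<sigma>\<^sup>2) + ereal (\<sigma>\<^sup>2 + 2 * \<sigma> * sqrt (1 - \<sigma>\<^sup>2) + \<sigma>) < ereal c"
  obtains k S \<gamma> where "h < ereal k" "k < 1" "\<sigma> < S" "S < 1" "0 < \<gamma>" "alternating_rate S k + 2 * \<gamma> \<le> c"
proof -
  define e where "e = \<sigma>\<^sup>2 + 2 * \<sigma> * sqrt (1 - \<sigma>\<^sup>2) + \<sigma>"
  have pos: "0 < 1 - \<sigma>\<^sup>2"
    using assms(2,3) by (simp add: abs_square_less_1)
  have "h < ereal ((c - e) / (1 - \<sigma>\<^sup>2))"
    using assms(1,4) pos by (cases h) (simp_all add: pos_less_divide_eq flip: e_def)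
  then have "h < min 1 (ereal ((c - e) / (1 - \<sigma>\<^sup>2)))"
    using assms(1) by simp
  then obtain k where k: "h < ereal k" "ereal k < min 1 (ereal ((c - e) / (1 - \<sigma>\<^sup>2)))"
    using ereal_dense2 by blast
  then have "k < 1" "k < (c - e) / (1 - \<sigma>\<^sup>2)"
    by auto
  then have "alternating_rate \<sigma> k < c"
    using pos by (simp add: alternating_rate_def pos_less_divide_eq flip: e_def)
  moreover have "((\<lambda>S. alternating_rate S k) \<longlongrightarrow> alternating_rate \<sigma> k) (at_right \<sigma>)"
    unfolding alternating_rate_def by (intro tendsto_intros)
  ultimately have "\<forall>\<^sub>F S in at_right \<sigma>. alternating_rate S k < c"
    using order_tendstoD(2) by blast
  moreover have "\<forall>\<^sub>F S in at_right \<sigma>. S \<in> {\<sigma><..<1}"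
    using assms(3) by (rule eventually_at_right_real)
  ultimately have "\<forall>\<^sub>F S in at_right \<sigma>. alternating_rate S k < c \<and> S \<in> {\<sigma><..<1}"
    by (rule eventually_conj)
  then obtain S where S: "alternating_rate S k < c" "\<sigma> < S" "S < 1"
    using eventually_happens[of _ "at_right \<sigma>"] by (auto simp: trivial_limit_at_right_real)
  show ?thesis
    by (rule that[of k S "(c - alternating_rate S k) / 2"]) (use k(1) \<open>k < 1\<close> S in \<open>auto simp: field_simps\<close>)
qed

theorem theorem34:
  fixes A B :: "'a::{real_inner, complete_space} set"
    and xbar :: 'a and \<sigma> c :: real
  assumes "closed A" and "closed B"
    and "xbar \<in> A \<inter> B"
    and "c_hat A B xbar < 1"
    and "super_regular_at A xbar"
    and "0 \<le> \<sigma>" and "\<sigma> < 1"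
    and "c_zero \<sigma> A B xbar < 1"
    and "c_zero \<sigma> A B xbar < ereal c" and "c < 1" and "0 < c"
  shows "\<exists>r>0. \<forall>x :: nat \<Rightarrow> 'a.
           sigma_alternating_projections \<sigma> A B x \<and>
           norm (x 0 - xbar) < r \<and> norm (x 1 - xbar) < r \<longrightarrow>
           (\<exists>l \<in> A \<inter> B. converges_R_linearly x l (sqrt c))"
proof -
  obtain k S \<gamma> where k: "c_hat A B xbar < ereal k" "k < 1" and S: "\<sigma> < S" "S < 1"
    and \<gamma>: "0 < \<gamma>" and kS\<gamma>: "alternating_rate S k + 2 * \<gamma> \<le> c"
    using parameter_choice[OF assms(4,6,7)] assms(9) unfolding c_zero_def by blast
  obtain \<rho> where \<rho>: "0 < \<rho>" and angle:
    "\<And>a b u v. a \<in> A \<inter> ball xbar \<rho> \<Longrightarrow> b \<in> B \<inter> ball xbar \<rho> \<Longrightarrow> u \<in> normal_cone A a \<Longrightarrow>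
      v \<in> normal_cone B b \<Longrightarrow> - inner u v \<le> k * norm u * norm v"
    using c_hat_local_bound[OF k(1)] by blast
  obtain \<delta>' where \<delta>': "0 < \<delta>'" and regular:
    "\<And>x a u. x \<in> A \<inter> ball xbar \<delta>' \<Longrightarrow> a \<in> A \<inter> ball xbar \<delta>' \<Longrightarrow> u \<in> normal_cone A a \<Longrightarrow>
      inner u (x - a) \<le> \<gamma> * norm u * norm (x - a)"
    using assms(5) \<gamma> unfolding super_regular_at_def by blast
  define \<delta> where "\<delta> = min \<rho> \<delta>'"
  have \<delta>: "0 < \<delta>" "ball xbar \<delta> \<subseteq> ball xbar \<rho>" "ball xbar \<delta> \<subseteq> ball xbar \<delta>'"
    using \<rho> \<delta>' by (auto simp: \<delta>_def)
  have step: "norm (b - a') \<le> c * norm (a - b)"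
    if a: "a \<in> A" and b: "b \<in> sigma_projection \<sigma> B a" and a': "a' \<in> sigma_projection \<sigma> A b"
      and le: "norm (b - a') \<le> norm (a - b)"
      and near: "a \<in> ball xbar \<delta>" "b \<in> ball xbar \<delta>" "a' \<in> ball xbar \<delta>" for a b a'
  proof -
    have mem: "b \<in> B" "infdist (a - b) (normal_cone B b) \<le> \<sigma> * norm (a - b)"
        "a' \<in> A" "infdist (b - a') (normal_cone A a') \<le> \<sigma> * norm (b - a')"
      using b a' by (auto simp: sigma_projection_def)
    obtain v where v: "v \<in> normal_cone B b" "inner v (a - b - v) = 0"
        "norm (a - b - v) \<le> S * norm (a - b)"
      using ray_projection[OF zero_in_normal_cone normal_cone_scaleR mem(2) S(1)] by blast
    obtain u where u: "u \<in> normal_cone A a'" "inner u (b - a' - u) = 0"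
        "norm (b - a' - u) \<le> S * norm (b - a')"
      using ray_projection[OF zero_in_normal_cone normal_cone_scaleR mem(4) S(1)] by blast
    have "- inner u v \<le> k * norm u * norm v"
      using angle[of a' b u v] mem near \<delta> u(1) v(1) by blast
    moreover have "inner u (a - a') \<le> \<gamma> * norm u * norm (a - a')"
      using regular[of a a' u] a mem near \<delta> u(1) by blast
    then have "inner u ((a - b) + (b - a')) \<le> \<gamma> * norm u * norm ((a - b) + (b - a'))"
      by simp
    ultimately show ?thesis
      using step_contraction[OF u(2,3) v(2,3)] le \<gamma> S(2) k(2) kS\<gamma> assms(10,11) by simp
  qed
  define r where "r = \<delta> / (1 + 4 / (c * (1 - c)))"
  have "0 < 4 / (c * (1 - c))"
    using assms(10,11) by simp
  then have r: "0 < r" "r * (1 + 4 / (c * (1 - c))) \<le> \<delta>"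
    using \<delta>(1) add_pos_pos[OF zero_less_one \<open>0 < 4 / (c * (1 - c))\<close>] unfolding r_def by auto
  have "\<exists>l \<in> A \<inter> B. converges_R_linearly x l (sqrt c)"
    if alt: "sigma_alternating_projections \<sigma> A B x"
      and init: "norm (x 0 - xbar) < r" "norm (x 1 - xbar) < r" for x :: "nat \<Rightarrow> 'a"
  proof -
    have projB: "x (2 * n + 1) \<in> sigma_projection \<sigma> B (x (2 * n))"
      and projA: "x (2 * n + 2) \<in> sigma_projection \<sigma> A (x (2 * n + 1))"
      and mono: "norm (x (n + 2) - x (n + 1)) \<le> norm (x (n + 1) - x n)" for n
      using alt unfolding sigma_alternating_projections_def by blast+
    have inB: "x (2 * n + 1) \<in> B" and inA: "x (2 * n + 2) \<in> A" for n
      using projB[of n] projA[of n] by (auto simp: sigma_projection_def)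
    have contr: "norm (x (2 * n + 2) - x (2 * n + 1)) \<le> c * norm (x (2 * n + 1) - x (2 * n))"
      if "1 \<le> n" and near: "x (2 * n) \<in> ball xbar \<delta>" "x (2 * n + 1) \<in> ball xbar \<delta>"
        "x (2 * n + 2) \<in> ball xbar \<delta>" for n
    proof -
      have "x (2 * n) \<in> A"
        using inA[of "n - 1"] \<open>1 \<le> n\<close> by (cases n) simp_all
      then show ?thesis
        using step[OF _ projB projA _ near] mono[of "2 * n"] by (simp add: norm_minus_commute)
    qed
    obtain l where l: "converges_R_linearly x l (sqrt c)"
      using local_contraction_converges[OF assms(11,10) mono contr init r(2)] by blast
    then have lim: "x \<longlonglongrightarrow> l"
      by (simp add: converges_R_linearly_def)
    have "(\<lambda>n. x (2 * n + 1)) \<longlonglongrightarrow> l" "(\<lambda>n. x (2 * n + 2)) \<longlonglongrightarrow> l"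
      using LIMSEQ_subseq_LIMSEQ[OF lim, of "\<lambda>n. 2 * n + 1"]
        LIMSEQ_subseq_LIMSEQ[OF lim, of "\<lambda>n. 2 * n + 2"]
      by (simp_all add: strict_mono_def o_def)
    then have "l \<in> A \<inter> B"
      using closed_sequentially[OF assms(1), of "\<lambda>n. x (2 * n + 2)" l]
        closed_sequentially[OF assms(2), of "\<lambda>n. x (2 * n + 1)" l] inA inB by blast
    with l show ?thesis by blast
  qed
  with r(1) show ?thesis by blast
qed

end
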